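(* Let $\varphi$ be a degree-$3$ tropical rational map with four break points $x_1<x_2<x_3<x_4$ and gap lengths $\ell_i=x_{i+1}-x_i$ ($i=1,2,3$), whose slope sequence is palindromic (i.e. is one of $(3,4,5,4,3)$, $(3,4,3,4,3)$, $(3,2,3,2,3)$, $(3,2,1,2,3)$). Then: - if $\ell_1\neq\ell_3$, then $\mathrm{Aut}(\varphi)=\{1\}$; - if $\ell_1=\ell_3$, then $\mathrm{Aut}(\varphi)\cong\mathbb{Z}/2\mathbb{Z}$.
   Context: The tropical projective line is $\mathbb{T}\mathbb{P}^1=\mathbb{R}\cup\{-\infty,+\infty\}$; its automorphism group $\mathrm{Aut}(\mathbb{T}\mathbb{P}^1)$ consists of the maps $x\mapsto\varepsilon x+b$, $\varepsilon\in\{\pm1\}$, $b\in\mathbb{R}$. A degree-$3$ tropical rational map is a continuous piecewise-linear function $\varphi:\mathbb{R}\to\mathbb{R}$ (extended to $\mathbb{T}\mathbb{P}^1\to\mathbb{T}\mathbb{P}^1$) with integer slopes and finitely many break points $x_1<\dots<x_k$ whose slope sequence $(s_0,\dots,s_k)$ ($s_i$ the slope on $(x_i,x_{i+1})$, $x_0=-\infty$, $x_{k+1}=+\infty$, consecutive slopes distinct) satisfies $s_0=s_k=3$ and $\sum_{i=1}^k|s_i-s_{i-1}|=4$. The automorphism group of $\varphi$ is $$\mathrm{Aut}(\varphi)=\{(\alpha,\beta)\in\mathrm{Aut}(\mathbb{T}\mathbb{P}^1)\times\mathrm{Aut}(\mathbb{T}\mathbb{P}^1) : \beta\circ\varphi=\varphi\circ\alpha\}.$$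 *)

theory Defs
  imports "HOL-Analysis.Analysis" "HOL-Algebra.Elementary_Groups"
begin

text \<open>The tropical projective line is the type \<^typ>\<open>ereal\<close>. The arithmetic of \<^typ>\<open>ereal\<close> makes
  \<open>x \<mapsto> \<epsilon> x + b\<close> fix both infinite points for \<open>\<epsilon> = 1\<close> and swap them for \<open>\<epsilon> = -1\<close>.\<close>

definition TP1_auts :: "(ereal \<Rightarrow> ereal) set" where
  "TP1_auts = {f. \<exists>\<epsilon>\<in>{1, -1::real}. \<exists>b::real. f = (\<lambda>x. ereal \<epsilon> * x + ereal b)}"

definition TP1_Aut :: "(ereal \<Rightarrow> ereal) monoid" where
  "TP1_Aut = \<lparr>carrier = TP1_auts, mult = (\<circ>), one = id\<rparr>"

text \<open>For break points \<open>xs\<close> (indexed from 0), \<open>pl_piece xs i\<close> is the open interval between the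
  break points \<open>xs ! (i - 1)\<close> and \<open>xs ! i\<close>, unbounded below for \<open>i = 0\<close> and unbounded above for
  \<open>i = length xs\<close>.\<close>

definition pl_piece :: "real list \<Rightarrow> nat \<Rightarrow> real set" where
  "pl_piece xs i = {t. (0 < i \<longrightarrow> xs ! (i - 1) < t) \<and> (i < length xs \<longrightarrow> t < xs ! i)}"

definition piecewise_linear_with :: "(real \<Rightarrow> real) \<Rightarrow> real list \<Rightarrow> int list \<Rightarrow> bool" where
  "piecewise_linear_with \<phi> xs ss \<longleftrightarrow>
     continuous_on UNIV \<phi> \<and>
     sorted_wrt (<) xs \<and>
     length ss = Suc (length xs) \<and>
     (\<forall>i<length xs. ss ! i \<noteq> ss ! Suc i) \<and>
     (\<forall>i\<le>length xs. \<exists>c. \<forall>t\<in>pl_piece xs i. \<phi> t = of_int (ss ! i) * t + c)"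

definition degree3_tropical_map_with :: "(real \<Rightarrow> real) \<Rightarrow> real list \<Rightarrow> int list \<Rightarrow> bool" where
  "degree3_tropical_map_with \<phi> xs ss \<longleftrightarrow>
     piecewise_linear_with \<phi> xs ss \<and>
     hd ss = 3 \<and> last ss = 3 \<and>
     (\<Sum>i<length xs. \<bar>ss ! Suc i - ss ! i\<bar>) = 4"

text \<open>The continuous extension of a map of the real line to the tropical projective line.\<close>

definition TP1_ext :: "(real \<Rightarrow> real) \<Rightarrow> ereal \<Rightarrow> ereal" where
  "TP1_ext \<phi> x =
     (case x of
        ereal r \<Rightarrow> ereal (\<phi> r)
      | PInfty \<Rightarrow> Lim at_top (\<lambda>r. ereal (\<phi> r))
      | MInfty \<Rightarrow> Lim at_bot (\<lambda>r. ereal (\<phi> r)))"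

definition tropical_Aut ::
  "(real \<Rightarrow> real) \<Rightarrow> ((ereal \<Rightarrow> ereal) \<times> (ereal \<Rightarrow> ereal)) monoid" where
  "tropical_Aut \<phi> =
     (TP1_Aut \<times>\<times> TP1_Aut)
       \<lparr>carrier := {(\<alpha>, \<beta>). \<alpha> \<in> carrier TP1_Aut \<and> \<beta> \<in> carrier TP1_Aut \<and>
                            \<beta> \<circ> TP1_ext \<phi> = TP1_ext \<phi> \<circ> \<alpha>}\<rparr>"

lemma TP1_affine_comp:
  assumes "\<epsilon> \<in> {1, -1::real}" "\<epsilon>' \<in> {1, -1::real}"
  shows "(\<lambda>x. ereal \<epsilon> * x + ereal b) \<circ> (\<lambda>x. ereal \<epsilon>' * x + ereal b') =
         (\<lambda>x. ereal (\<epsilon> * \<epsilon>') * x + ereal (\<epsilon> * b' + b))"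
proof
  fix x :: ereal
  show "((\<lambda>x. ereal \<epsilon> * x + ereal b) \<circ> (\<lambda>x. ereal \<epsilon>' * x + ereal b')) x =
        ereal (\<epsilon> * \<epsilon>') * x + ereal (\<epsilon> * b' + b)"
    using assms by (cases x) (auto simp: algebra_simps)
qed

lemma TP1_affine_id: "(\<lambda>x. ereal 1 * x + ereal 0) = id"
  by (auto simp: fun_eq_iff zero_ereal_def[symmetric] one_ereal_def[symmetric])

lemma TP1_autsI: "\<epsilon> \<in> {1, -1::real} \<Longrightarrow> (\<lambda>x. ereal \<epsilon> * x + ereal b) \<in> TP1_auts"
  unfolding TP1_auts_def by blast

lemma TP1_autsE:
  assumes "f \<in> TP1_auts"
  obtains \<epsilon> b where "\<epsilon> \<in> {1, -1::real}" "f = (\<lambda>x. ereal \<epsilon> * x + ereal b)"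
  using assms unfolding TP1_auts_def by blast

lemma group_TP1_Aut: "group TP1_Aut"
proof (rule groupI)
  show "\<one>\<^bsub>TP1_Aut\<^esub> \<in> carrier TP1_Aut"
    using TP1_autsI[of 1 0, unfolded TP1_affine_id] by (simp add: TP1_Aut_def)
next
  fix f g assume "f \<in> carrier TP1_Aut" "g \<in> carrier TP1_Aut"
  then have f: "f \<in> TP1_auts" and g: "g \<in> TP1_auts" by (simp_all add: TP1_Aut_def)
  from f obtain \<epsilon> b where f: "\<epsilon> \<in> {1, -1::real}" "f = (\<lambda>x. ereal \<epsilon> * x + ereal b)"
    by (rule TP1_autsE)
  from g obtain \<epsilon>' b' where g: "\<epsilon>' \<in> {1, -1::real}" "g = (\<lambda>x. ereal \<epsilon>' * x + ereal b')"
    by (rule TP1_autsE)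
  have "\<epsilon> * \<epsilon>' \<in> {1, -1}" using f(1) g(1) by auto
  then have "f \<circ> g \<in> TP1_auts"
    unfolding f(2) g(2) TP1_affine_comp[OF f(1) g(1)] by (rule TP1_autsI)
  then show "f \<otimes>\<^bsub>TP1_Aut\<^esub> g \<in> carrier TP1_Aut" by (simp add: TP1_Aut_def)
next
  fix f g h :: "ereal \<Rightarrow> ereal"
  show "f \<otimes>\<^bsub>TP1_Aut\<^esub> g \<otimes>\<^bsub>TP1_Aut\<^esub> h = f \<otimes>\<^bsub>TP1_Aut\<^esub> (g \<otimes>\<^bsub>TP1_Aut\<^esub> h)"
    by (simp add: TP1_Aut_def comp_assoc)
  show "\<one>\<^bsub>TP1_Aut\<^esub> \<otimes>\<^bsub>TP1_Aut\<^esub> f = f" by (simp add: TP1_Aut_def)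
next
  fix f assume "f \<in> carrier TP1_Aut"
  then have "f \<in> TP1_auts" by (simp add: TP1_Aut_def)
  then obtain \<epsilon> b where e: "\<epsilon> \<in> {1, -1::real}" and f: "f = (\<lambda>x. ereal \<epsilon> * x + ereal b)"
    by (rule TP1_autsE)
  let ?g = "\<lambda>x. ereal \<epsilon> * x + ereal (- (\<epsilon> * b))"
  have one: "\<epsilon> * \<epsilon> = 1" and zero: "\<epsilon> * b + - (\<epsilon> * b) = 0" using e by auto
  have "?g \<circ> f = id"
    unfolding f TP1_affine_comp[OF e e] one zero by (rule TP1_affine_id)
  moreover have "?g \<in> TP1_auts" using e by (rule TP1_autsI)
  ultimately show "\<exists>g\<in>carrier TP1_Aut. g \<otimes>\<^bsub>TP1_Aut\<^esub> f = \<one>\<^bsub>TP1_Aut\<^esub>"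
    unfolding TP1_Aut_def monoid.simps partial_object.simps by (rule bexI)
qed

lemma subgroup_tropical_Aut: "subgroup (carrier (tropical_Aut \<phi>)) (TP1_Aut \<times>\<times> TP1_Aut)"
proof -
  interpret A: group TP1_Aut by (rule group_TP1_Aut)
  interpret P: group "TP1_Aut \<times>\<times> TP1_Aut" by (intro DirProd_group group_TP1_Aut)
  let ?\<Phi> = "TP1_ext \<phi>"
  have mult: "f \<otimes>\<^bsub>TP1_Aut\<^esub> g = f \<circ> g" and one: "\<one>\<^bsub>TP1_Aut\<^esub> = id" for f g
    by (simp_all add: TP1_Aut_def)
  show ?thesis
  proof (rule P.subgroupI)
    show "carrier (tropical_Aut \<phi>) \<noteq> {}"
      using A.one_closed by (auto simp: tropical_Aut_def one intro!: exI[of _ id])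
  next
    fix p assume "p \<in> carrier (tropical_Aut \<phi>)"
    then obtain \<alpha> \<beta> where p: "p = (\<alpha>, \<beta>)" and a: "\<alpha> \<in> carrier TP1_Aut" and b: "\<beta> \<in> carrier TP1_Aut"
      and eq: "\<beta> \<circ> ?\<Phi> = ?\<Phi> \<circ> \<alpha>" by (auto simp: tropical_Aut_def)
    let ?a = "inv\<^bsub>TP1_Aut\<^esub> \<alpha>" and ?b = "inv\<^bsub>TP1_Aut\<^esub> \<beta>"
    have ia: "\<alpha> \<circ> ?a = id" and ib: "?b \<circ> \<beta> = id"
      using A.r_inv[OF a] A.l_inv[OF b] by (simp_all add: mult one)
    have "?b \<circ> ?\<Phi> = ?b \<circ> (?\<Phi> \<circ> \<alpha>) \<circ> ?a" by (simp add: comp_assoc ia)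
    also have "\<dots> = (?b \<circ> \<beta>) \<circ> ?\<Phi> \<circ> ?a" by (simp only: eq[symmetric] comp_assoc)
    finally have "?b \<circ> ?\<Phi> = ?\<Phi> \<circ> ?a" by (simp add: ib)
    then show "inv\<^bsub>TP1_Aut \<times>\<times> TP1_Aut\<^esub> p \<in> carrier (tropical_Aut \<phi>)"
      using a b by (simp add: p inv_DirProd[OF group_TP1_Aut group_TP1_Aut] tropical_Aut_def)
  next
    fix p q assume "p \<in> carrier (tropical_Aut \<phi>)" "q \<in> carrier (tropical_Aut \<phi>)"
    then obtain \<alpha> \<beta> \<alpha>' \<beta>' where p: "p = (\<alpha>, \<beta>)" and q: "q = (\<alpha>', \<beta>')"
      and in_carrier: "\<alpha> \<in> carrier TP1_Aut" "\<beta> \<in> carrier TP1_Aut"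
        "\<alpha>' \<in> carrier TP1_Aut" "\<beta>' \<in> carrier TP1_Aut"
      and eq: "\<beta> \<circ> ?\<Phi> = ?\<Phi> \<circ> \<alpha>" "\<beta>' \<circ> ?\<Phi> = ?\<Phi> \<circ> \<alpha>'" by (auto simp: tropical_Aut_def)
    have "(\<beta> \<circ> \<beta>') \<circ> ?\<Phi> = ?\<Phi> \<circ> (\<alpha> \<circ> \<alpha>')"
      using eq by (auto simp: fun_eq_iff)
    moreover have "\<alpha> \<circ> \<alpha>' \<in> carrier TP1_Aut" "\<beta> \<circ> \<beta>' \<in> carrier TP1_Aut"
      using in_carrier A.m_closed by (simp_all add: mult[symmetric])
    ultimately show "p \<otimes>\<^bsub>TP1_Aut \<times>\<times> TP1_Aut\<^esub> q \<in> carrier (tropical_Aut \<phi>)"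
      by (simp add: p q mult tropical_Aut_def)
  next
    show "carrier (tropical_Aut \<phi>) \<subseteq> carrier (TP1_Aut \<times>\<times> TP1_Aut)"
      by (auto simp: tropical_Aut_def)
  qed
qed

lemma group_tropical_Aut: "group (tropical_Aut \<phi>)"
  using subgroup.subgroup_is_group[OF subgroup_tropical_Aut[of \<phi>]
      DirProd_group[OF group_TP1_Aut group_TP1_Aut]]
  by (simp add: tropical_Aut_def)

lemma degree3_tropical_map_TP1_ext_infinity:
  assumes "degree3_tropical_map_with \<phi> xs ss"
  shows "TP1_ext \<phi> \<infinity> = \<infinity>" and "TP1_ext \<phi> (-\<infinity>) = -\<infinity>"
proof -
  let ?n = "length xs"
  have len: "length ss = Suc ?n" and hd: "ss ! 0 = 3" and last: "ss ! ?n = 3"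
    and lin: "\<And>i. i \<le> ?n \<Longrightarrow> \<exists>c. \<forall>t\<in>pl_piece xs i. \<phi> t = of_int (ss ! i) * t + c"
  proof -
    show "length ss = Suc ?n"
      and "\<And>i. i \<le> ?n \<Longrightarrow> \<exists>c. \<forall>t\<in>pl_piece xs i. \<phi> t = of_int (ss ! i) * t + c"
      using assms by (simp_all add: degree3_tropical_map_with_def piecewise_linear_with_def)
    then have "ss \<noteq> []" by auto
    then show "ss ! 0 = 3" "ss ! ?n = 3"
      using assms[unfolded degree3_tropical_map_with_def] \<open>length ss = Suc ?n\<close>
      by (simp_all add: hd_conv_nth[symmetric] last_conv_nth)
  qed
  obtain c where "\<forall>t\<in>pl_piece xs ?n. \<phi> t = of_int (ss ! ?n) * t + c"
    using lin[OF order_refl] by blast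
  then have c: "3 * t + c = \<phi> t" if "t \<in> pl_piece xs ?n" for t
    using that last by simp
  obtain d where "\<forall>t\<in>pl_piece xs 0. \<phi> t = of_int (ss ! 0) * t + d"
    using lin[OF le0] by blast
  then have d: "3 * t + d = \<phi> t" if "t \<in> pl_piece xs 0" for t
    using that hd by simp
  have "\<forall>\<^sub>F t in at_top. 3 * t + c = \<phi> t"
    using eventually_gt_at_top[of "xs ! (?n - 1)"]
    by eventually_elim (simp add: c pl_piece_def)
  moreover have "filterlim (\<lambda>t::real. 3 * t + c) at_top at_top"
    unfolding filterlim_at_top
  proof
    fix Z :: real
    show "\<forall>\<^sub>F t in at_top. Z \<le> 3 * t + c"
      using eventually_ge_at_top[of "(Z - c) / 3"] by eventually_elim simp
  qed
  ultimately have "filterlim \<phi> at_top at_top"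
    by (rule filterlim_cong[OF refl refl, THEN iffD1])
  then have "((\<lambda>t. ereal (\<phi> t)) \<longlongrightarrow> \<infinity>) at_top"
    by (rule tendsto_PInfty_eq_at_top[THEN iffD2])
  then have "Lim at_top (\<lambda>t. ereal (\<phi> t)) = \<infinity>"
    by (rule tendsto_Lim[OF trivial_limit_at_top_linorder])
  moreover have "TP1_ext \<phi> \<infinity> = Lim at_top (\<lambda>t. ereal (\<phi> t))"
    unfolding TP1_ext_def infinity_ereal_def by (simp only: ereal.case)
  ultimately show "TP1_ext \<phi> \<infinity> = \<infinity>" by (rule trans[rotated])
  have "\<forall>\<^sub>F t in at_bot. 3 * t + d = \<phi> t"
    using eventually_gt_at_bot[of "xs ! 0"]
    by eventually_elim (simp add: d pl_piece_def)
  moreover have "filterlim (\<lambda>t::real. 3 * t + d) at_bot at_bot"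
    unfolding filterlim_at_bot
  proof
    fix Z :: real
    show "\<forall>\<^sub>F t in at_bot. 3 * t + d \<le> Z"
      using eventually_le_at_bot[of "(Z - d) / 3"] by eventually_elim simp
  qed
  ultimately have "filterlim \<phi> at_bot at_bot"
    by (rule filterlim_cong[OF refl refl, THEN iffD1])
  then have "((\<lambda>t. ereal (\<phi> t)) \<longlongrightarrow> -\<infinity>) at_bot"
    unfolding tendsto_MInfty filterlim_at_bot_dense by simp
  then have "Lim at_bot (\<lambda>t. ereal (\<phi> t)) = -\<infinity>"
    by (rule tendsto_Lim[OF trivial_limit_at_bot_linorder])
  moreover have "TP1_ext \<phi> (-\<infinity>) = Lim at_bot (\<lambda>t. ereal (\<phi> t))"
    unfolding TP1_ext_def by simp
  ultimately show "TP1_ext \<phi> (-\<infinity>) = -\<infinity>" by (rule trans[rotated])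
qed

lemma degree3_four_breaks_palindromic_iff:
  assumes "degree3_tropical_map_with \<phi> [x1, x2, x3, x4] ss"
  shows "rev ss = ss \<longleftrightarrow>
         ss \<in> {[3,4,5,4,3], [3,4,3,4,3], [3,2,3,2,3], [3,2,1,2,3]}"
proof -
  have "length ss = Suc (Suc (Suc (Suc (Suc 0))))"
    using assms by (simp add: degree3_tropical_map_with_def piecewise_linear_with_def)
  then obtain a b c d e where ss: "ss = [a, b, c, d, e]"
    by (simp only: length_Suc_conv length_0_conv) blast
  have n: "length [x1, x2, x3, x4] = 4" by simp
  have neq: "\<forall>i<4. ss ! i \<noteq> ss ! Suc i" and sum: "(\<Sum>i<4. \<bar>ss ! Suc i - ss ! i\<bar>) = 4"
    and ends: "hd ss = 3" "last ss = 3"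
    using assms[unfolded degree3_tropical_map_with_def piecewise_linear_with_def n] by simp_all
  have ae: "a = 3" "e = 3" using ends by (simp_all add: ss)
  have bc: "3 \<noteq> b" "b \<noteq> c"
    using neq[rule_format, of 0] neq[rule_format, of 1] by (simp_all add: ss ae)
  have sum4: "(\<Sum>i<4. f i) = f 0 + f 1 + f 2 + f 3" for f :: "nat \<Rightarrow> int"
    by (simp add: eval_nat_numeral)
  have nth: "ss ! 0 = 3" "ss ! Suc 0 = b" "ss ! 1 = b" "ss ! Suc 1 = c" "ss ! 2 = c"
    "ss ! Suc 2 = d" "ss ! 3 = d" "ss ! Suc 3 = 3"
    by (simp_all add: ss ae)
  have abs: "\<bar>b - 3\<bar> + \<bar>c - b\<bar> + \<bar>d - c\<bar> + \<bar>3 - d\<bar> = 4"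
    using sum unfolding sum4 nth .
  show ?thesis
  proof
    assume "rev ss = ss"
    then have "rev ss ! 1 = ss ! 1" by (rule arg_cong)
    then have d: "d = b" by (simp add: ss)
    have one: "\<bar>b - 3\<bar> = 1" "\<bar>c - b\<bar> = 1" using abs bc unfolding d by linarith+
    then have "b = 4 \<or> b = 2" "c = b + 1 \<or> c = b - 1" by linarith+
    then show "ss \<in> {[3,4,5,4,3], [3,4,3,4,3], [3,2,3,2,3], [3,2,1,2,3]}"
      unfolding ss ae d by (elim disjE) simp_all
  next
    assume "ss \<in> {[3,4,5,4,3], [3,4,3,4,3], [3,2,3,2,3], [3,2,1,2,3]}"
    then show "rev ss = ss" by (elim insertE emptyE) simp_all
  qed
qed

end

theory Submission
  imports Defs
begin

text \<open>The break points of a piecewise linear map are exactly the points where it is not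
  differentiable (\<open>piecewise_linear_differentiable_iff\<close>). An automorphism is a
  relation \<open>\<phi> (\<epsilon> * t + b) = \<delta> * \<phi> t + c\<close>, so \<open>t \<mapsto> \<epsilon> * t + b\<close> permutes the break points. Because \<open>\<phi>\<close> fixes both points at infinity, \<open>\<alpha>\<close> and \<open>\<beta>\<close> must agree
  there, which forces \<open>\<delta> = \<epsilon>\<close>.

  A translation that permutes a nonempty finite set of reals is the identity. A reflection reverses
  the order of the set, so it must send the \<open>i\<close>-th break point to the \<open>i\<close>-th from the end; for four
  break points this is possible iff \<open>\<ell>\<^sub>1 = \<ell>\<^sub>3\<close>, and then the reflection is \<open>t \<mapsto> x\<^sub>1 + x\<^sub>4 - t\<close>. Hence
  \<open>\<phi>\<close> has at most one nontrivial automorphism, and none if \<open>\<ell>\<^sub>1 \<noteq> \<ell>\<^sub>3\<close>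
  (\<open>nontrivial_automorphism_is_reflection\<close>). Conversely, if the break
  points are symmetric under \<open>t \<mapsto> b - t\<close> and the slopes are palindromic, then \<open>\<phi> t + \<phi> (b - t)\<close>
  is a continuous function whose derivative vanishes off a finite set. It is therefore a constant
  \<open>c\<close>, and the pair of \<open>t \<mapsto> b - t\<close> and \<open>y \<mapsto> c - y\<close> is the nontrivial automorphism
  (\<open>reflection_automorphism_exists\<close>). These arguments work for any
  positive number of break points; the number four enters only when the reflections of the list of
  break points are determined.\<close>

section \<open>Break points as points of nondifferentiability\<close>

lemma open_pl_piece: "open (pl_piece xs i)"
proof -
  have "pl_piece xs i = (if 0 < i then {xs ! (i - 1)<..} else UNIV) \<inter>
                        (if i < length xs then {..<xs ! i} else UNIV)"
    by (auto simp: pl_piece_def)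
  then show ?thesis by (simp add: open_Int)
qed

lemma non_break_point_in_piece:
  assumes "t \<notin> set xs"
  obtains i where "i \<le> length xs" "t \<in> pl_piece xs i"
proof -
  define i where "i = (LEAST i. length xs \<le> i \<or> t < xs ! i)"
  have i: "length xs \<le> i \<or> t < xs ! i"
    unfolding i_def by (rule LeastI[of _ "length xs"]) simp
  have le: "i \<le> length xs" unfolding i_def by (rule Least_le) simp
  have "xs ! (i - 1) < t" if "0 < i"
  proof -
    from that have "\<not> (length xs \<le> i - 1 \<or> t < xs ! (i - 1))"
      unfolding i_def by (intro not_less_Least) simp
    moreover from this have "xs ! (i - 1) \<noteq> t" using assms by (metis not_le nth_mem)
    ultimately show ?thesis by simp
  qed
  with i le have "t \<in> pl_piece xs i" by (auto simp: pl_piece_def)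
  with le that show thesis by blast
qed

lemma piecewise_linear_DERIV:
  assumes "piecewise_linear_with \<phi> xs ss" "i \<le> length xs" "t \<in> pl_piece xs i"
  shows "(\<phi> has_real_derivative of_int (ss ! i)) (at t)"
proof -
  obtain c where c: "\<forall>u\<in>pl_piece xs i. \<phi> u = of_int (ss ! i) * u + c"
    using assms unfolding piecewise_linear_with_def by blast
  have "((\<lambda>u. of_int (ss ! i) * u + c) has_real_derivative of_int (ss ! i)) (at t)"
    by (auto intro!: derivative_eq_intros)
  then show ?thesis
    by (rule has_field_derivative_transform_within_open[OF _ open_pl_piece assms(3)]) (use c in simp)
qed

text \<open>Up to its end points a piece still has an affine formula, by continuity; the derivative at an
  end point can then only be the slope of that piece. Applied to the two pieces that meet at a break
  point, this contradicts the inequality of consecutive slopes.\<close>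

lemma piecewise_linear_one_sided_slope:
  assumes pl: "piecewise_linear_with \<phi> xs ss" and i: "i \<le> length xs"
    and ab: "a < b" "{a<..<b} \<subseteq> pl_piece xs i" and x: "x \<in> {a..b}"
    and D: "(\<phi> has_real_derivative D) (at x)"
  shows "D = of_int (ss ! i)"
proof -
  obtain c where c: "\<forall>t\<in>pl_piece xs i. \<phi> t = of_int (ss ! i) * t + c"
    using pl i unfolding piecewise_linear_with_def by blast
  have cont: "continuous_on UNIV \<phi>" using pl by (simp add: piecewise_linear_with_def)
  have eq: "of_int (ss ! i) * t + c = \<phi> t" if "t \<in> {a..b}" for t
  proof -
    have "\<phi> t - of_int (ss ! i) * t = c"
    proof (rule continuous_constant_on_closure[of "{a<..<b}" "\<lambda>t. \<phi> t - of_int (ss ! i) * t"])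
      show "continuous_on (closure {a<..<b}) (\<lambda>t. \<phi> t - of_int (ss ! i) * t)"
        by (intro continuous_intros continuous_on_subset[OF cont]) simp
    qed (use c ab that in auto)
    then show ?thesis by simp
  qed
  have "((\<lambda>t. of_int (ss ! i) * t + c) has_real_derivative of_int (ss ! i)) (at x within {a..b})"
    by (auto intro!: derivative_eq_intros)
  then have "(\<phi> has_real_derivative of_int (ss ! i)) (at x within {a..b})"
    by (rule has_field_derivative_transform_within[OF _ zero_less_one x]) (rule eq)
  moreover have "(\<phi> has_real_derivative D) (at x within {a..b})"
    using D by (rule has_field_derivative_at_within)
  ultimately show ?thesis
    using vector_derivative_unique_within_closed_interval[of a b x \<phi>] ab x
    by (simp add: has_real_derivative_iff_has_vector_derivative)
qed

lemma piecewise_linear_differentiable_iff: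
  assumes pl: "piecewise_linear_with \<phi> xs ss"
  shows "\<phi> differentiable (at t) \<longleftrightarrow> t \<notin> set xs"
proof
  assume "t \<notin> set xs"
  then obtain i where "i \<le> length xs" "t \<in> pl_piece xs i" by (rule non_break_point_in_piece)
  then show "\<phi> differentiable (at t)"
    using piecewise_linear_DERIV[OF pl] real_differentiable_def by blast
next
  assume "\<phi> differentiable (at t)"
  then obtain D where D: "(\<phi> has_real_derivative D) (at t)"
    by (auto simp: real_differentiable_def)
  show "t \<notin> set xs"
  proof
    assume "t \<in> set xs"
    then obtain i where i: "i < length xs" "xs ! i = t" by (auto simp: in_set_conv_nth)
    have sorted: "xs ! j < xs ! k" if "j < k" "k < length xs" for j k
      using pl that sorted_wrt_nth_less by (auto simp: piecewise_linear_with_def)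
    obtain a where a: "a < t" "{a<..<t} \<subseteq> pl_piece xs i"
    proof
      show "(if 0 < i then xs ! (i - 1) else t - 1) < t" using sorted[of "i - 1" i] i by auto
    qed (use i in \<open>auto simp: pl_piece_def\<close>)
    obtain b where b: "t < b" "{t<..<b} \<subseteq> pl_piece xs (Suc i)"
    proof
      show "t < (if Suc i < length xs then xs ! Suc i else t + 1)" using sorted[of i "Suc i"] i by auto
    qed (use i in \<open>auto simp: pl_piece_def\<close>)
    have "D = of_int (ss ! i)"
      by (rule piecewise_linear_one_sided_slope[OF pl _ a _ D]) (use i a in auto)
    moreover have "D = of_int (ss ! Suc i)"
      by (rule piecewise_linear_one_sided_slope[OF pl _ b _ D]) (use i b in auto)
    ultimately have "ss ! i = ss ! Suc i" by simp
    then show False using pl i by (simp add: piecewise_linear_with_def)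
  qed
qed

section \<open>Affine symmetries of a piecewise linear map\<close>

lemma differentiable_affine_transport:
  fixes f g :: "real \<Rightarrow> real"
  assumes "\<And>t. g t = p * f (q * t + b) + c" "f differentiable (at (q * t + b))"
  shows "g differentiable (at t)"
proof -
  obtain D where "(f has_real_derivative D) (at (q * t + b))"
    using assms(2) by (auto simp: real_differentiable_def)
  then have "((\<lambda>t. f (q * t + b)) has_real_derivative D * q) (at t)"
    by (rule DERIV_chain2) (auto intro!: derivative_eq_intros)
  then have "((\<lambda>t. p * f (q * t + b) + c) has_real_derivative p * (D * q)) (at t)"
    by (auto intro!: derivative_eq_intros)
  moreover have "g = (\<lambda>t. p * f (q * t + b) + c)" using assms(1) by (rule ext)
  ultimately show ?thesis unfolding real_differentiable_def by blast
qed

text \<open>The relation expresses \<open>\<phi>\<close> near \<open>t\<close> through \<open>\<phi>\<close> near \<open>\<epsilon> * t + b\<close>, and, as \<open>\<epsilon>\<close> is its own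
  inverse, also the other way round, so differentiability is transported in both directions.\<close>

lemma affine_symmetry_permutes_break_points:
  assumes pl: "piecewise_linear_with \<phi> xs ss" and e: "\<epsilon> \<in> {1, -1}"
    and sym: "\<And>t. \<phi> (\<epsilon> * t + b) = \<epsilon> * \<phi> t + c"
  shows "(\<lambda>t. \<epsilon> * t + b) ` set xs = set xs"
proof -
  have inv: "\<epsilon> * \<epsilon> = 1" using e by auto
  have iff: "\<epsilon> * t + b \<in> set xs \<longleftrightarrow> t \<in> set xs" for t
  proof -
    have "\<phi> t = \<epsilon> * \<phi> (\<epsilon> * t + b) + (- \<epsilon> * c)" for t
      using e by (auto simp: sym)
    moreover have "\<phi> u = \<epsilon> * \<phi> (\<epsilon> * u + (- \<epsilon> * b)) + c" for u
      using sym[of "\<epsilon> * u - \<epsilon> * b"] e by (auto simp: algebra_simps)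
    moreover have "\<epsilon> * (\<epsilon> * t + b) + (- \<epsilon> * b) = t" using e by auto
    ultimately have "\<phi> differentiable (at (\<epsilon> * t + b)) \<longleftrightarrow> \<phi> differentiable (at t)"
      using differentiable_affine_transport[of \<phi> \<epsilon> \<phi>] by metis
    then show ?thesis by (simp add: piecewise_linear_differentiable_iff[OF pl])
  qed
  show ?thesis
  proof (intro equalityI subsetI)
    fix u assume u: "u \<in> set xs"
    have "u = \<epsilon> * (\<epsilon> * (u - b)) + b" using e by auto
    with u iff[of "\<epsilon> * (u - b)"] show "u \<in> (\<lambda>t. \<epsilon> * t + b) ` set xs" by auto
  qed (use iff in auto)
qed

lemma translation_symmetry_trivial:
  assumes pl: "piecewise_linear_with \<phi> xs ss" and "xs \<noteq> []"
    and sym: "\<And>t. \<phi> (t + b) = \<phi> t + c"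
  shows "b = 0" "c = 0"
proof -
  have "(\<lambda>t. t + b) ` set xs = set xs"
    using affine_symmetry_permutes_break_points[OF pl, of 1 b c] sym by simp
  moreover have sorted: "sorted_wrt (<) xs" using pl by (simp add: piecewise_linear_with_def)
  ultimately have "map (\<lambda>t. t + b) xs = xs"
    by (intro strict_sorted_equal) (auto simp: sorted_wrt_map)
  then have "hd xs + b = hd xs" using \<open>xs \<noteq> []\<close> by (metis hd_map)
  then show "b = 0" by simp
  then show "c = 0" using sym[of 0] by simp
qed

lemma reflection_symmetry_reverses_break_points:
  assumes pl: "piecewise_linear_with \<phi> xs ss"
    and sym: "\<And>t. \<phi> (b - t) = c - \<phi> t"
  shows "map (\<lambda>t. b - t) (rev xs) = xs"
proof -
  have "(\<lambda>t. b - t) ` set xs = set xs"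
    using affine_symmetry_permutes_break_points[OF pl, of "-1" b c] sym by simp
  moreover have "sorted_wrt (<) xs" using pl by (simp add: piecewise_linear_with_def)
  ultimately show ?thesis
    by (intro strict_sorted_equal) (auto simp: sorted_wrt_map sorted_wrt_rev)
qed

lemma reflect_pl_piece:
  assumes xs: "map (\<lambda>t. b - t) (rev xs) = xs" and i: "i \<le> length xs" and t: "t \<in> pl_piece xs i"
  shows "b - t \<in> pl_piece xs (length xs - i)"
proof -
  have nth: "xs ! j = b - xs ! (length xs - Suc j)" if "j < length xs" for j
    using that arg_cong[OF xs, of "\<lambda>l. l ! j"] by (simp add: rev_nth)
  show ?thesis
    using t i nth[of "length xs - i - 1"] nth[of "length xs - i"]
    by (auto simp: pl_piece_def Suc_diff_Suc)
qed

text \<open>On the piece with index \<open>i\<close> the two summands of \<open>\<phi> t + \<phi> (b - t)\<close> have slopes \<open>ss ! i\<close> and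
  \<open>- ss ! (n - i)\<close>, where \<open>n\<close> is the number of break points; palindromicity makes them cancel.\<close>

lemma symmetric_data_imp_reflection_symmetry:
  assumes pl: "piecewise_linear_with \<phi> xs ss" and ss: "rev ss = ss"
    and xs: "map (\<lambda>t. b - t) (rev xs) = xs"
  obtains c where "\<And>t. \<phi> (b - t) = c - \<phi> t"
proof -
  let ?g = "\<lambda>t. \<phi> t + \<phi> (b - t)"
  have cont: "continuous_on UNIV \<phi>" and len: "length ss = Suc (length xs)"
    using pl by (simp_all add: piecewise_linear_with_def)
  have "(?g has_real_derivative 0) (at t)" if "t \<notin> set xs" for t
  proof -
    from that obtain i where i: "i \<le> length xs" "t \<in> pl_piece xs i"
      by (rule non_break_point_in_piece)
    have "ss ! (length xs - i) = ss ! i"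
      using i len arg_cong[OF ss, of "\<lambda>l. l ! i"] by (simp add: rev_nth)
    moreover have "b - t \<in> pl_piece xs (length xs - i)" by (rule reflect_pl_piece[OF xs i])
    ultimately have "(\<phi> has_real_derivative of_int (ss ! i)) (at (b - t))"
      using piecewise_linear_DERIV[OF pl, of "length xs - i"] by simp
    then have "((\<lambda>t. \<phi> (b - t)) has_real_derivative of_int (ss ! i) * -1) (at t)"
      by (rule DERIV_chain2) (auto intro!: derivative_eq_intros)
    from DERIV_add[OF piecewise_linear_DERIV[OF pl i] this] show ?thesis by simp
  qed
  moreover have "continuous_on UNIV ?g"
    by (intro continuous_intros cont continuous_on_compose2[OF cont]) simp_all
  ultimately have "?g constant_on UNIV"
    by (intro DERIV_zero_connected_constant_on[of _ "set xs"]) auto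
  then obtain c where "\<And>t. ?g t = c" by (auto simp: constant_on_def)
  then have "\<phi> (b - t) = c - \<phi> t" for t by (simp add: eq_diff_eq add.commute)
  then show thesis by (rule that)
qed

section \<open>Automorphisms as affine symmetries\<close>

definition TP1_affine :: "real \<Rightarrow> real \<Rightarrow> ereal \<Rightarrow> ereal" where
  "TP1_affine \<epsilon> b = (\<lambda>x. ereal \<epsilon> * x + ereal b)"

lemma TP1_affine_real [simp]: "TP1_affine \<epsilon> b (ereal t) = ereal (\<epsilon> * t + b)"
  by (simp add: TP1_affine_def)

lemma TP1_affine_infinity:
  assumes "\<epsilon> \<in> {1, -1}"
  shows "TP1_affine \<epsilon> b \<infinity> = ereal \<epsilon> * \<infinity>" "TP1_affine \<epsilon> b (-\<infinity>) = ereal \<epsilon> * (-\<infinity>)"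
  using assms by (auto simp: TP1_affine_def)

lemma TP1_affine_in_carrier: "\<epsilon> \<in> {1, -1} \<Longrightarrow> TP1_affine \<epsilon> b \<in> carrier TP1_Aut"
  by (auto simp: TP1_affine_def TP1_Aut_def TP1_auts_def)

lemma TP1_affine_1_0: "TP1_affine 1 0 = id"
  unfolding TP1_affine_def by (rule TP1_affine_id)

text \<open>Comparing the two sides of the commutation relation at \<open>\<infinity>\<close> shows that \<open>\<alpha>\<close> and \<open>\<beta>\<close> have the
  same sign.\<close>

lemma TP1_affine_commutes_iff:
  assumes deg: "degree3_tropical_map_with \<phi> xs ss" and e: "\<epsilon> \<in> {1, -1}" "\<delta> \<in> {1, -1}"
  shows "TP1_affine \<delta> c \<circ> TP1_ext \<phi> = TP1_ext \<phi> \<circ> TP1_affine \<epsilon> b \<longleftrightarrow>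
         \<delta> = \<epsilon> \<and> (\<forall>t. \<phi> (\<epsilon> * t + b) = \<epsilon> * \<phi> t + c)" (is "?L \<longleftrightarrow> ?R")
proof
  note infinity = degree3_tropical_map_TP1_ext_infinity[OF deg]
  have ext [simp]: "TP1_ext \<phi> (ereal t) = ereal (\<phi> t)" for t by (simp add: TP1_ext_def)
  {
    assume ?L
    then have L: "TP1_affine \<delta> c (TP1_ext \<phi> x) = TP1_ext \<phi> (TP1_affine \<epsilon> b x)" for x
      by (auto simp: fun_eq_iff)
    have "ereal \<delta> * \<infinity> = TP1_ext \<phi> (ereal \<epsilon> * \<infinity>)"
      using L[of \<infinity>] e by (simp only: TP1_affine_infinity infinity)
    then have "\<delta> = \<epsilon>" using e infinity by auto
    moreover have "\<phi> (\<epsilon> * t + b) = \<delta> * \<phi> t + c" for t using L[of "ereal t"] by simp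
    ultimately show ?R by simp
  next
    assume R: ?R
    show ?L
    proof
      fix x show "(TP1_affine \<delta> c \<circ> TP1_ext \<phi>) x = (TP1_ext \<phi> \<circ> TP1_affine \<epsilon> b) x"
      proof (cases x)
        case (real r) with R show ?thesis by simp
      qed (use R e in \<open>auto simp: TP1_affine_infinity infinity\<close>)
    qed
  }
qed

lemma carrier_tropical_Aut_iff:
  assumes "degree3_tropical_map_with \<phi> xs ss"
  shows "p \<in> carrier (tropical_Aut \<phi>) \<longleftrightarrow>
         (\<exists>\<epsilon>\<in>{1, -1}. \<exists>b c. p = (TP1_affine \<epsilon> b, TP1_affine \<epsilon> c) \<and>
                           (\<forall>t. \<phi> (\<epsilon> * t + b) = \<epsilon> * \<phi> t + c))" (is "_ \<longleftrightarrow> ?R")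
proof
  assume "p \<in> carrier (tropical_Aut \<phi>)"
  then obtain \<alpha> \<beta> where p: "p = (\<alpha>, \<beta>)" "\<alpha> \<in> TP1_auts" "\<beta> \<in> TP1_auts"
    and eq: "\<beta> \<circ> TP1_ext \<phi> = TP1_ext \<phi> \<circ> \<alpha>"
    by (auto simp: tropical_Aut_def TP1_Aut_def)
  from p obtain \<epsilon> b \<delta> c where "\<epsilon> \<in> {1, -1}" "\<delta> \<in> {1, -1}"
    and "\<alpha> = TP1_affine \<epsilon> b" "\<beta> = TP1_affine \<delta> c"
    unfolding TP1_affine_def by (metis TP1_autsE)
  with p eq TP1_affine_commutes_iff[OF assms] show ?R by metis
next
  assume ?R
  then show "p \<in> carrier (tropical_Aut \<phi>)"
    using TP1_affine_in_carrier TP1_affine_commutes_iff[OF assms]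
    by (auto simp: tropical_Aut_def)
qed

lemma one_tropical_Aut: "\<one>\<^bsub>tropical_Aut \<phi>\<^esub> = (id, id)"
  by (simp add: tropical_Aut_def TP1_Aut_def)

text \<open>With a reflection \<open>t \<mapsto> b - t\<close> the constant \<open>c\<close> is determined by \<open>b\<close>, so at most one \<open>p\<close> arises
  once \<open>b\<close> is known from the break points.\<close>

lemma nontrivial_automorphism_is_reflection:
  assumes deg: "degree3_tropical_map_with \<phi> xs ss" and "xs \<noteq> []"
    and p: "p \<in> carrier (tropical_Aut \<phi>)" "p \<noteq> \<one>\<^bsub>tropical_Aut \<phi>\<^esub>"
  shows "\<exists>b. map (\<lambda>t. b - t) (rev xs) = xs \<and> p = (TP1_affine (-1) b, TP1_affine (-1) (\<phi> 0 + \<phi> b))"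
proof -
  have pl: "piecewise_linear_with \<phi> xs ss" using deg by (simp add: degree3_tropical_map_with_def)
  obtain \<epsilon> b c where e: "\<epsilon> \<in> {1, -1}" and p': "p = (TP1_affine \<epsilon> b, TP1_affine \<epsilon> c)"
    and sym: "\<And>t. \<phi> (\<epsilon> * t + b) = \<epsilon> * \<phi> t + c"
    using p(1) unfolding carrier_tropical_Aut_iff[OF deg] by blast
  have "\<epsilon> \<noteq> 1"
  proof
    assume "\<epsilon> = 1"
    with sym have "b = 0" "c = 0"
      using translation_symmetry_trivial[OF pl \<open>xs \<noteq> []\<close>, of b c] by simp_all
    with \<open>\<epsilon> = 1\<close> p' p(2) show False by (simp add: TP1_affine_1_0 one_tropical_Aut)
  qed
  with e have e: "\<epsilon> = -1" by simp
  with sym have refl: "\<phi> (b - t) = c - \<phi> t" for t by simp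
  have "c = \<phi> 0 + \<phi> b" using refl[of 0] by simp
  then show ?thesis
    using p' e reflection_symmetry_reverses_break_points[OF pl refl] by auto
qed

lemma reflection_automorphism_exists:
  assumes deg: "degree3_tropical_map_with \<phi> xs ss" and "rev ss = ss"
    and "map (\<lambda>t. b - t) (rev xs) = xs"
  shows "(TP1_affine (-1) b, TP1_affine (-1) (\<phi> 0 + \<phi> b)) \<in> carrier (tropical_Aut \<phi>)"
proof -
  have "piecewise_linear_with \<phi> xs ss" using deg by (simp add: degree3_tropical_map_with_def)
  then obtain c where c: "\<And>t. \<phi> (b - t) = c - \<phi> t"
    using symmetric_data_imp_reflection_symmetry assms by metis
  then have "c = \<phi> 0 + \<phi> b" using c[of 0] by simp
  with c show ?thesis
    unfolding carrier_tropical_Aut_iff[OF deg] by (intro bexI[of _ "-1"] exI) auto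
qed

section \<open>The automorphism group\<close>

lemma (in group) two_element_group_iso_integer_mod_2:
  assumes carrier: "carrier G = {\<one>, r}" and "r \<noteq> \<one>"
  shows "G \<cong> integer_mod_group 2"
proof -
  have r: "r \<in> carrier G" using carrier by simp
  have "r \<otimes> r \<noteq> r" using r \<open>r \<noteq> \<one>\<close> by simp
  then have rr: "r \<otimes> r = \<one>" using m_closed[OF r r] carrier by auto
  have "(\<lambda>x. if x = \<one> then 0 else 1) \<in> iso G (integer_mod_group 2)"
    using r rr \<open>r \<noteq> \<one>\<close>
    by (auto simp: iso_def hom_def bij_betw_def inj_on_def carrier carrier_integer_mod_group)
  then show ?thesis by (auto simp: is_iso_def)
qed

theorem proposition4:
  fixes \<phi> :: "real \<Rightarrow> real" and x1 x2 x3 x4 :: real and ss :: "int list"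
  assumes "degree3_tropical_map_with \<phi> [x1, x2, x3, x4] ss"
    and "rev ss = ss"
  shows "(x2 - x1 \<noteq> x4 - x3 \<longrightarrow> carrier (tropical_Aut \<phi>) = {\<one>\<^bsub>tropical_Aut \<phi>\<^esub>}) \<and>
         (x2 - x1 = x4 - x3 \<longrightarrow> tropical_Aut \<phi> \<cong> integer_mod_group 2)"
proof -
  interpret group "tropical_Aut \<phi>" by (rule group_tropical_Aut)
  let ?r = "(TP1_affine (-1) (x1 + x4), TP1_affine (-1) (\<phi> 0 + \<phi> (x1 + x4)))"
  have rev_iff: "map (\<lambda>t. b - t) (rev [x1, x2, x3, x4]) = [x1, x2, x3, x4] \<longleftrightarrow>
                 b = x1 + x4 \<and> x2 - x1 = x4 - x3" for b
    by auto
  have nontrivial: "x2 - x1 = x4 - x3 \<and> p = ?r"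
    if "p \<in> carrier (tropical_Aut \<phi>)" "p \<noteq> \<one>\<^bsub>tropical_Aut \<phi>\<^esub>" for p
    using nontrivial_automorphism_is_reflection[OF assms(1) _ that] unfolding rev_iff by auto
  show ?thesis
  proof (intro conjI impI)
    assume "x2 - x1 \<noteq> x4 - x3"
    then show "carrier (tropical_Aut \<phi>) = {\<one>\<^bsub>tropical_Aut \<phi>\<^esub>}" using nontrivial by blast
  next
    assume "x2 - x1 = x4 - x3"
    then have r: "?r \<in> carrier (tropical_Aut \<phi>)"
      using reflection_automorphism_exists[OF assms, of "x1 + x4"] rev_iff by blast
    \<comment> \<open>The reflection is not the identity because it swaps the points at infinity.\<close>
    have "TP1_affine (-1) (x1 + x4) \<infinity> \<noteq> id \<infinity>" by (simp add: TP1_affine_infinity)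
    then have "?r \<noteq> \<one>\<^bsub>tropical_Aut \<phi>\<^esub>" unfolding one_tropical_Aut by force
    moreover have "carrier (tropical_Aut \<phi>) = {\<one>\<^bsub>tropical_Aut \<phi>\<^esub>, ?r}"
      using nontrivial r by blast
    ultimately show "tropical_Aut \<phi> \<cong> integer_mod_group 2"
      by (intro two_element_group_iso_integer_mod_2)
  qed
qed

end
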